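(* Let $A\in\mathbb{R}^{m\times n}$ with $m\le n$, $I\subset\{1,\dots,n\}$ and $s\in\{-1,1\}^I$. Then $(I,s)$ is a Recoverable Support of $A$ if and only if $A_I$ has full rank and there exists $y\in\ker(A_I^T)$ such that $$\|A_{I^c}^T(A_I^T)^\dagger s+A_{I^c}^Ty\|_\infty<1.$$
   Context: For $A\in\mathbb{R}^{m\times n}$ and $I\subset\{1,\dots,n\}$, $A_I$ denotes the submatrix of $A$ formed by the columns indexed by $I$, $A_I^T$ its transpose, and $I^c=\{1,\dots,n\}\setminus I$. $(A_I^T)^\dagger$ is the (Moore–Penrose) pseudo-inverse of $A_I^T$. "$A_I$ has full rank" means that $A_I$ is injective, i.e. its columns are linearly independent. A sup-norm over an empty index set is $0$. A pair $(I,s)$ with $I\subset\{1,\dots,n\}$, $|I|\le m$, and $s\in\{-1,1\}^I$ is a Recoverable Support of $A$ (of size $|I|$) if $A_I$ has full rank and there exists $w\in\mathbb{R}^m$ with $A_I^Tw=s$ and $\|A_{I^c}^Tw\|_\infty<1$. *)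

theory Defs
  imports
    "Jordan_Normal_Form.Matrix_Kernel"
    "Jordan_Normal_Form.DL_Submatrix"
begin

(* Columns are numbered 0, ..., n - 1, so index sets are subsets of {..<n}.  The columns of
   cols_sub A I appear in increasing order of their index: its column j is column pick I j of A,
   where pick I enumerates I increasingly. *)
definition cols_sub :: "real mat \<Rightarrow> nat set \<Rightarrow> real mat" where
  "cols_sub A I = submatrix A UNIV I"

definition compl_idx :: "real mat \<Rightarrow> nat set \<Rightarrow> nat set" where
  "compl_idx A I = {..<dim_col A} - I"

definition full_rank :: "real mat \<Rightarrow> bool" where
  "full_rank B \<longleftrightarrow> inj_on (\<lambda>x. B *\<^sub>v x) (carrier_vec (dim_col B))"

(* The set {-1, 1}^I for a finite set I with k elements; entry i of such a vector belongs to the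
   index pick I i, in agreement with the column order of cols_sub A I. *)
definition sign_vecs :: "nat \<Rightarrow> real vec set" where
  "sign_vecs k = {s \<in> carrier_vec k. \<forall>i<k. s $ i \<in> {-1, 1}}"

(* The value 0 is inserted to make the norm of the vector of dimension 0 equal to 0;
   otherwise it does not affect the maximum. *)
definition sup_norm_vec :: "real vec \<Rightarrow> real" where
  "sup_norm_vec v = Max (insert 0 {\<bar>v $ i\<bar> | i. i < dim_vec v})"

(* The four Penrose conditions *)
definition is_pinv :: "real mat \<Rightarrow> real mat \<Rightarrow> bool" where
  "is_pinv B X \<longleftrightarrow>
     X \<in> carrier_mat (dim_col B) (dim_row B) \<and>
     B * X * B = B \<and>
     X * B * X = X \<and>
     transpose_mat (B * X) = B * X \<and>
     transpose_mat (X * B) = X * B"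

definition pinv :: "real mat \<Rightarrow> real mat" where
  "pinv B = (THE X. is_pinv B X)"

lemma is_pinv_unique:
  assumes "is_pinv B X" and "is_pinv B Y"
  shows "X = Y"
proof -
  define r c where "r = dim_row B" and "c = dim_col B"
  have B: "B \<in> carrier_mat r c" by (simp add: r_def c_def)
  have X: "X \<in> carrier_mat c r" and X1: "B * X * B = B" and X2: "X * B * X = X"
    and X3: "transpose_mat (B * X) = B * X" and X4: "transpose_mat (X * B) = X * B"
    using assms(1) by (auto simp: is_pinv_def r_def c_def)
  have Y: "Y \<in> carrier_mat c r" and Y1: "B * Y * B = B" and Y2: "Y * B * Y = Y"
    and Y3: "transpose_mat (B * Y) = B * Y" and Y4: "transpose_mat (Y * B) = Y * B"
    using assms(2) by (auto simp: is_pinv_def r_def c_def)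
  have BX: "B * X \<in> carrier_mat r r" and BY: "B * Y \<in> carrier_mat r r"
    and XB: "X * B \<in> carrier_mat c c" and YB: "Y * B \<in> carrier_mat c c"
    using B X Y by auto
  have "B * X = (B * Y) * (B * X)"
    using Y1 assoc_mult_mat[OF BY B X] by simp
  hence "transpose_mat (B * X) = transpose_mat (B * X) * transpose_mat (B * Y)"
    using transpose_mult[OF BY BX] by simp
  hence "B * X = (B * X) * (B * Y)" by (simp only: X3 Y3)
  also have "\<dots> = B * Y" using X1 assoc_mult_mat[OF BX B Y] by simp
  finally have l: "B * X = B * Y" .
  have "X * B = (X * B) * (Y * B)"
    using Y1 assoc_mult_mat[OF X B YB] assoc_mult_mat[OF B Y B] by simp
  hence "transpose_mat (X * B) = transpose_mat (Y * B) * transpose_mat (X * B)"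
    using transpose_mult[OF XB YB] by simp
  hence "X * B = (Y * B) * (X * B)" by (simp only: X4 Y4)
  also have "\<dots> = Y * B"
    using X1 assoc_mult_mat[OF Y B XB] assoc_mult_mat[OF B X B] by simp
  finally have r: "X * B = Y * B" .
  have "X = Y * B * X" using X2 r by simp
  also have "\<dots> = Y * (B * Y)" using assoc_mult_mat[OF Y B X] l by simp
  also have "\<dots> = Y" using assoc_mult_mat[OF Y B Y] Y2 by simp
  finally show ?thesis .
qed

lemma pinv_eqI: "is_pinv B X \<Longrightarrow> pinv B = X"
  unfolding pinv_def by (blast intro: the_equality is_pinv_unique)

definition recoverable_support :: "real mat \<Rightarrow> nat set \<Rightarrow> real vec \<Rightarrow> bool" where
  "recoverable_support A I s \<longleftrightarrow>
     I \<subseteq> {..<dim_col A} \<and> card I \<le> dim_row A \<and> s \<in> sign_vecs (card I) \<and>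
     full_rank (cols_sub A I) \<and>
     (\<exists>w \<in> carrier_vec (dim_row A).
        transpose_mat (cols_sub A I) *\<^sub>v w = s \<and>
        sup_norm_vec (transpose_mat (cols_sub A (compl_idx A I)) *\<^sub>v w) < 1)"

end

theory Submission
  imports Defs "Jordan_Normal_Form.Determinant"
begin

text \<open>
  If \<open>B = A\<^sub>I\<close> is injective, then the Gram matrix \<open>B\<^sup>T B\<close> is invertible and the pseudo-inverse of
  \<open>B\<^sup>T\<close> is \<open>B (B\<^sup>T B)\<^sup>-\<^sup>1\<close>, a right inverse of \<open>B\<^sup>T\<close>. Hence the solutions \<open>w\<close> of \<open>B\<^sup>T w = s\<close> are
  exactly the vectors \<open>(B\<^sup>T)\<^sup>\<dagger> s + y\<close> with \<open>y\<close> in the kernel of \<open>B\<^sup>T\<close>.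
\<close>

lemma full_rankD:
  assumes "full_rank B" and "B \<in> carrier_mat m k" and "v \<in> carrier_vec k" and "B *\<^sub>v v = 0\<^sub>v m"
  shows "v = 0\<^sub>v k"
proof -
  have "B *\<^sub>v 0\<^sub>v k = 0\<^sub>v m" using assms(2) by (intro eq_vecI) simp_all
  with assms(4) have "B *\<^sub>v v = B *\<^sub>v 0\<^sub>v k" by simp
  moreover have "inj_on (\<lambda>x. B *\<^sub>v x) (carrier_vec k)"
    using assms(1,2) unfolding full_rank_def by (simp only: carrier_matD)
  ultimately show ?thesis using assms(3) by (meson inj_onD zero_carrier_vec)
qed

text \<open>If \<open>B\<close> had more columns than rows, padding it with zero rows to a square
  matrix would give determinant 0, hence a nonzero kernel vector, which \<open>B\<close> would also
  annihilate. This supplies the size bound that \<open>recoverable_support\<close> demands and the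
  right-hand side of the theorem does not state.\<close>

lemma full_rank_dim_col_le:
  assumes "full_rank B" and B: "B \<in> carrier_mat m k"
  shows "k \<le> m"
proof (rule ccontr)
  assume "\<not> k \<le> m"
  hence km: "m < k" by simp
  define c where "c i = (if i < m then row B i else 0\<^sub>v k)" for i
  \<comment> \<open>Row \<open>m\<close> is the first padding row; it exists because
    \<open>m < k\<close>. Singling it out brings \<open>C\<close> into the form that
    \<open>det_row_0\<close> expects.\<close>
  define C where "C = mat\<^sub>r k k (\<lambda>i. if i = m then 0\<^sub>v k else c i)"
  have C: "C \<in> carrier_mat k k" by (simp add: C_def)
  have "det C = 0"
    unfolding C_def using km B by (intro det_row_0) (auto simp: c_def)
  then obtain v where v: "v \<in> carrier_vec k" "v \<noteq> 0\<^sub>v k" "C *\<^sub>v v = 0\<^sub>v k"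
    using det_0_iff_vec_prod_zero[OF C] by blast
  have "B *\<^sub>v v = 0\<^sub>v m"
  proof (rule eq_vecI)
    fix i assume "i < dim_vec (0\<^sub>v m)"
    hence i: "i < m" by simp
    have "row C i = row B i" using i km B by (auto simp: C_def c_def)
    moreover have "(C *\<^sub>v v) $ i = 0" using v(3) i km by simp
    ultimately show "(B *\<^sub>v v) $ i = 0\<^sub>v m $ i" using i km B C by simp
  qed (use B in simp)
  thus False using full_rankD[OF assms(1) B v(1)] v(2) by simp
qed

text \<open>A vector \<open>v\<close> killed by the Gram matrix satisfies
  \<open>(B *\<^sub>v v) \<bullet> (B *\<^sub>v v) = 0\<close>, so \<open>B\<close> kills
  \<open>v\<close> as well.\<close>

lemma gram_det_nonzero:
  assumes "full_rank B" and B: "B \<in> carrier_mat m k"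
  shows "det (transpose_mat B * B) \<noteq> 0"
proof
  have G: "transpose_mat B * B \<in> carrier_mat k k" using B by simp
  assume "det (transpose_mat B * B) = 0"
  then obtain v where v: "v \<in> carrier_vec k" "v \<noteq> 0\<^sub>v k" "(transpose_mat B * B) *\<^sub>v v = 0\<^sub>v k"
    using det_0_iff_vec_prod_zero[OF G] by blast
  have Bv: "B *\<^sub>v v \<in> carrier_vec m" using B v(1) by simp
  have "transpose_mat B *\<^sub>v (B *\<^sub>v v) = 0\<^sub>v k" using v B by simp
  hence "(B *\<^sub>v v) \<bullet> (B *\<^sub>v v) = 0"
    using transpose_vec_mult_scalar[OF B v(1) Bv] v(1) by simp
  hence "B *\<^sub>v v = 0\<^sub>v m" using conjugate_square_eq_0_vec[OF Bv] by simp
  thus False using full_rankD[OF assms(1) B v(1)] v(2) by simp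
qed

lemma pinv_transpose_full_rank:
  assumes "full_rank B" and B: "B \<in> carrier_mat m k"
  shows "pinv (transpose_mat B) \<in> carrier_mat m k"
    and "transpose_mat B * pinv (transpose_mat B) = 1\<^sub>m k"
proof -
  define G where "G = transpose_mat B * B"
  have BT: "transpose_mat B \<in> carrier_mat k m" using B by simp
  have G: "G \<in> carrier_mat k k" using B by (simp add: G_def)
  have GT: "transpose_mat G = G" using transpose_mult[OF BT B] by (simp add: G_def)
  \<comment> \<open>A nonzero determinant makes \<open>G\<close> a unit of the matrix ring, hence
    two-sidedly invertible; \<open>()\<close> fills the extension slot of the record
    \<open>ring_mat\<close>.\<close>
  obtain H where H: "H \<in> carrier_mat k k" and HG: "H * G = 1\<^sub>m k" and GH: "G * H = 1\<^sub>m k"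
    using det_non_zero_imp_unit[OF G, of "()"] gram_det_nonzero[OF assms]
    by (auto simp: Units_def ring_mat_def G_def)
  have HT: "transpose_mat H = H"
  proof -
    \<comment> \<open>Transposing \<open>G * H = 1\<^sub>m k\<close> with \<open>G\<close> symmetric
      shows that the transpose of \<open>H\<close> is also a left inverse of \<open>G\<close>;
      multiplying by \<open>H\<close> on the right identifies it with \<open>H\<close>.\<close>
    have "transpose_mat H * G = 1\<^sub>m k" using transpose_mult[OF G H] GH GT by simp
    hence "transpose_mat H * G * H = H" using H by simp
    thus ?thesis using assoc_mult_mat[of "transpose_mat H" k k G k H k] G H GH by simp
  qed
  define X where "X = B * H"
  have X: "X \<in> carrier_mat m k" using B H by (simp add: X_def)
  have BX: "transpose_mat B * X = 1\<^sub>m k"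
    using assoc_mult_mat[OF BT B H] GH by (simp add: X_def G_def)
  \<comment> \<open>Three of the Penrose equations follow at once from \<open>BX\<close>. The
    remaining one, symmetry of \<open>X * transpose_mat B\<close>, is inherited from the symmetry of
    \<open>H\<close>.\<close>
  have "transpose_mat (X * transpose_mat B) = X * transpose_mat B"
    using transpose_mult[OF X BT] transpose_mult[OF B H] assoc_mult_mat[OF B H BT] HT
    by (simp add: X_def)
  hence "is_pinv (transpose_mat B) X"
    using B X BX assoc_mult_mat[OF X BT X] by (auto simp: is_pinv_def)
  hence "pinv (transpose_mat B) = X" by (rule pinv_eqI)
  thus "pinv (transpose_mat B) \<in> carrier_mat m k"
    and "transpose_mat B * pinv (transpose_mat B) = 1\<^sub>m k" using X BX by simp_all
qed

lemma cols_sub_carrier: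
  assumes "A \<in> carrier_mat m n" and "I \<subseteq> {..<n}"
  shows "cols_sub A I \<in> carrier_mat m (card I)"
proof -
  have "{j. j < n \<and> j \<in> I} = I" using assms(2) by auto
  hence "dim_col (cols_sub A I) = card I"
    using assms(1) by (simp only: cols_sub_def dim_submatrix carrier_matD)
  moreover have "dim_row (cols_sub A I) = m"
    using assms(1) by (simp add: cols_sub_def dim_submatrix)
  ultimately show ?thesis by (intro carrier_matI)
qed

theorem theorem5:
  fixes A :: "real mat" and m n :: nat and I :: "nat set" and s :: "real vec"
  assumes "A \<in> carrier_mat m n" and "m \<le> n"
    and "I \<subseteq> {..<n}" and "s \<in> sign_vecs (card I)"
  shows "recoverable_support A I s \<longleftrightarrow>
    full_rank (cols_sub A I) \<and>
    (\<exists>y \<in> mat_kernel (transpose_mat (cols_sub A I)).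
       sup_norm_vec
         (transpose_mat (cols_sub A (compl_idx A I)) *\<^sub>v (pinv (transpose_mat (cols_sub A I)) *\<^sub>v s)
          + transpose_mat (cols_sub A (compl_idx A I)) *\<^sub>v y) < 1)"
proof (cases "full_rank (cols_sub A I)")
  case False
  thus ?thesis by (simp add: recoverable_support_def)
next
  case True
  define k B C where "k = card I" and "B = cols_sub A I" and "C = cols_sub A (compl_idx A I)"
  define p where "p = pinv (transpose_mat B) *\<^sub>v s"
  have B: "B \<in> carrier_mat m k" using cols_sub_carrier[OF assms(1,3)] by (simp add: B_def k_def)
  have fr: "full_rank B" using True by (simp add: B_def)
  have BT: "transpose_mat B \<in> carrier_mat k m" using B by simp
  have "compl_idx A I \<subseteq> {..<n}" using assms(1) by (auto simp: compl_idx_def)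
  hence CT: "transpose_mat C \<in> carrier_mat (card (compl_idx A I)) m"
    using cols_sub_carrier[OF assms(1)] by (simp add: C_def)
  have s: "s \<in> carrier_vec k" using assms(4) by (simp add: sign_vecs_def k_def)
  note P = pinv_transpose_full_rank[OF fr B]
  have p: "p \<in> carrier_vec m" using P(1) s by (simp add: p_def)
  have Bp: "transpose_mat B *\<^sub>v p = s"
    using assoc_mult_mat_vec[OF BT P(1) s] P(2) s by (simp add: p_def)
  \<comment> \<open>The two witnesses correspond by the translation \<open>w = p + y\<close>, under
    which the vectors inside the sup-norms coincide by linearity.\<close>
  have "(\<exists>w \<in> carrier_vec m. transpose_mat B *\<^sub>v w = s \<and> sup_norm_vec (transpose_mat C *\<^sub>v w) < 1)
    \<longleftrightarrow> (\<exists>y \<in> mat_kernel (transpose_mat B).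
          sup_norm_vec (transpose_mat C *\<^sub>v p + transpose_mat C *\<^sub>v y) < 1)" (is "?L \<longleftrightarrow> ?R")
  proof
    assume ?L
    then obtain w where w: "w \<in> carrier_vec m" "transpose_mat B *\<^sub>v w = s"
      "sup_norm_vec (transpose_mat C *\<^sub>v w) < 1" by blast
    have "transpose_mat B *\<^sub>v (w - p) = 0\<^sub>v k"
      using mult_minus_distrib_mat_vec[OF BT w(1) p] w(2) Bp s by simp
    hence "w - p \<in> mat_kernel (transpose_mat B)" using mat_kernelI[OF BT] w(1) p by simp
    moreover have "p + (w - p) = w" using w(1) p by (intro eq_vecI) auto
    hence "transpose_mat C *\<^sub>v p + transpose_mat C *\<^sub>v (w - p) = transpose_mat C *\<^sub>v w"
      using mult_add_distrib_mat_vec[OF CT p, of "w - p"] w(1) p by simp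
    ultimately show ?R using w(3) by metis
  next
    assume ?R
    then obtain y where y: "y \<in> mat_kernel (transpose_mat B)"
      "sup_norm_vec (transpose_mat C *\<^sub>v p + transpose_mat C *\<^sub>v y) < 1" by blast
    note yD = mat_kernelD[OF BT y(1)]
    have "transpose_mat B *\<^sub>v (p + y) = s"
      using mult_add_distrib_mat_vec[OF BT p yD(1)] yD(2) Bp s by simp
    moreover have "sup_norm_vec (transpose_mat C *\<^sub>v (p + y)) < 1"
      using mult_add_distrib_mat_vec[OF CT p yD(1)] y(2) by simp
    ultimately show ?L using p yD(1) by (intro bexI[of _ "p + y"]) auto
  qed
  \<comment> \<open>What remains of \<open>recoverable_support\<close> is the bound on
    \<open>card I\<close>, which injectivity of \<open>B\<close> forces.\<close>
  thus ?thesis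
    using assms full_rank_dim_col_le[OF fr B] fr
    by (auto simp: recoverable_support_def p_def B_def C_def k_def)
qed

end
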